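(* Let $\mathfrak{a}$ and $\mathfrak{b}$ be confocal ellipses in the Euclidean plane. Let $\mathcal{A}$ and $\mathcal{B}$ denote the billiard maps in $\mathfrak{a}$ and $\mathfrak{b}$, respectively, acting on the space of oriented lines intersecting both ellipses. Then $\mathcal{A}\mathcal{B}=\mathcal{B}\mathcal{A}$, i.e. the two maps commute.
   Context: Two ellipses in the Euclidean plane are confocal if they have the same foci. The billiard map in an ellipse $\mathfrak{e}$ acts on oriented lines that intersect $\mathfrak{e}$: it sends the incoming billiard trajectory to the outgoing one. Explicitly, given an oriented line $\ell$ meeting $\mathfrak{e}$, let $X$ be the last point of $\mathfrak{e}$ on $\ell$ in the direction of $\ell$ (the point where the moving particle inside $\mathfrak{e}$ hits the boundary; if $\ell$ is tangent to $\mathfrak{e}$, $X$ is the tangency point). The image of $\ell$ is the oriented line through $X$ whose direction vector is the image of the direction vector of $\ell$ under the reflection in the tangent line to $\mathfrak{e}$ at $X$ (angle of incidence equals angle of reflection). *)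

theory Defs
  imports "HOL-Analysis.Analysis"
begin

type_synonym plane = "real ^ 2"

definition ellipse_with_foci :: "plane \<Rightarrow> plane \<Rightarrow> plane set \<Rightarrow> bool" where
  "ellipse_with_foci f1 f2 E \<longleftrightarrow>
     (\<exists>r. dist f1 f2 < r \<and> E = {X. dist X f1 + dist X f2 = r})"

definition confocal_ellipses :: "plane set \<Rightarrow> plane set \<Rightarrow> bool" where
  "confocal_ellipses E E' \<longleftrightarrow>
     (\<exists>f1 f2. ellipse_with_foci f1 f2 E \<and> ellipse_with_foci f1 f2 E')"

text \<open>
  An oriented line is the pair of its set of points and its unit direction vector. This
  representation is unique, so equality of pairs is equality of oriented lines.
\<close>

type_synonym oriented_line = "plane set \<times> plane"

definition oriented_line_through :: "plane \<Rightarrow> plane \<Rightarrow> oriented_line" where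
  "oriented_line_through X u = (range (\<lambda>t. X + t *\<^sub>R u), u)"

definition oriented_lines :: "oriented_line set" where
  "oriented_lines = {oriented_line_through X u | X u. norm u = 1}"

definition oriented_lines_meeting_both :: "plane set \<Rightarrow> plane set \<Rightarrow> oriented_line set" where
  "oriented_lines_meeting_both E E' =
     {l \<in> oriented_lines. fst l \<inter> E \<noteq> {} \<and> fst l \<inter> E' \<noteq> {}}"

text \<open>
  The velocities at X of the curves in E that pass through X. At a point of an ellipse they
  form the one-dimensional direction space of the tangent line.
\<close>

definition tangent_space :: "plane set \<Rightarrow> plane \<Rightarrow> plane set" where
  "tangent_space E X =
     {v. \<exists>\<gamma> :: real \<Rightarrow> plane. range \<gamma> \<subseteq> E \<and> \<gamma> 0 = X \<and> (\<gamma> has_vector_derivative v) (at 0)}"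

text \<open>
  On a linear subspace T, the closest point is the orthogonal projection, so this is the
  reflection that fixes T and negates its orthogonal complement.
\<close>

definition reflect_in :: "plane set \<Rightarrow> plane \<Rightarrow> plane" where
  "reflect_in T v = 2 *\<^sub>R closest_point T v - v"

definition exit_point :: "plane set \<Rightarrow> oriented_line \<Rightarrow> plane" where
  "exit_point E l = arg_max_on (\<lambda>X. X \<bullet> snd l) (fst l \<inter> E)"

text \<open>
  Only meaningful for oriented lines that meet E; elsewhere the exit point is an arbitrary point.
\<close>

definition billiard_map :: "plane set \<Rightarrow> oriented_line \<Rightarrow> oriented_line" where
  "billiard_map E l =
     (let X = exit_point E l
      in oriented_line_through X (reflect_in (tangent_space E X) (snd l)))"

end

(*
In principal axes, with a and a - e the squared semiaxes, write an oriented line with direction (s, c)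
as {x c - y s = p}. The quantity M = p^2 + e s^2 depends only on the confocal family, not on a; it labels
the confocal conic to which the line is tangent, and the line meets the ellipse a iff M <= a. The lines
with given M form the intersection of quadrics s^2 + c^2 = 1, p^2 + e s^2 = M, which is uniformised by
Jacobi elliptic functions (s, c, p/sqrt M) = (sn, cn, dn). Reflection in the ellipse a preserves M and acts
on this curve as translation by an element depending only on a and M, i.e. by the addition formulas for
sn, cn, dn. Two translations commute.
*)

theory Submission
  imports Defs
begin

section \<open>Addition on an intersection of two quadrics\<close>

definition add_curve :: "real \<Rightarrow> real \<Rightarrow> (real \<times> real \<times> real) set" where
  "add_curve e M = {(s, c, p). s\<^sup>2 + c\<^sup>2 = 1 \<and> p\<^sup>2 + e * s\<^sup>2 = M}"

text \<open>For \<open>M > 0\<close> these are the relations of (sn t / sqrt M, cn t, dn t) with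
  squared modulus e / M; those of the curve belong to (sn t, cn t, sqrt M dn t).\<close>

definition add_shifts :: "real \<Rightarrow> real \<Rightarrow> (real \<times> real \<times> real) set" where
  "add_shifts e M = {(S, C, D). C\<^sup>2 + M * S\<^sup>2 = 1 \<and> D\<^sup>2 + e * S\<^sup>2 = 1 \<and> (C \<noteq> 0 \<or> D \<noteq> 0)}"

text \<open>
  The addition formulas for sn, cn, dn. A shift is scaled so that no division by the modulus or by \<open>M\<close>
  occurs, and the formulas stay meaningful in the degenerate cases \<open>e = 0\<close>, \<open>M = 0\<close> and \<open>M = e\<close>. The
  condition \<open>C \<noteq> 0 \<or> D \<noteq> 0\<close> in \<open>add_shifts\<close> keeps the denominators away from 0.
\<close>

fun add_map :: "real \<Rightarrow> real \<times> real \<times> real \<Rightarrow> real \<times> real \<times> real \<Rightarrow> real \<times> real \<times> real" where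
  "add_map e (S, C, D) (s, c, p) =
     ((s * C * D + S * c * p) / (1 - e * S\<^sup>2 * s\<^sup>2),
      (c * C - S * s * p * D) / (1 - e * S\<^sup>2 * s\<^sup>2),
      (p * D - e * S * s * c * C) / (1 - e * S\<^sup>2 * s\<^sup>2))"

text \<open>On the curve the denominator is the sum of squares c^2 + D^2 s^2. If it vanished, then c
  = D = 0, and the remaining relations would give C = 0, which \<open>add_shifts\<close>
  excludes.\<close>

lemma add_denominator_pos:
  assumes "(s, c, p) \<in> add_curve e M" "(S, C, D) \<in> add_shifts e M" "e \<ge> 0"
  shows "1 - e * S\<^sup>2 * s\<^sup>2 > 0"
proof -
  have cv: "s\<^sup>2 + c\<^sup>2 = 1" "p\<^sup>2 + e * s\<^sup>2 = M" using assms(1) by (auto simp: add_curve_def)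
  have sh: "C\<^sup>2 + M * S\<^sup>2 = 1" "D\<^sup>2 + e * S\<^sup>2 = 1" "C \<noteq> 0 \<or> D \<noteq> 0"
    using assms(2) by (auto simp: add_shifts_def)
  have eq: "1 - e * S\<^sup>2 * s\<^sup>2 = c\<^sup>2 + D\<^sup>2 * s\<^sup>2"
    using cv sh by algebra
  have "c\<^sup>2 + D\<^sup>2 * s\<^sup>2 \<noteq> 0"
  proof
    assume z: "c\<^sup>2 + D\<^sup>2 * s\<^sup>2 = 0"
    have c0: "c = 0" using z
      by (metis add_nonneg_eq_0_iff mult_nonneg_nonneg power2_eq_iff_nonneg zero_le_power2 zero_eq_power2)
    then have s1: "s\<^sup>2 = 1" using cv by simp
    have D0: "D = 0" using z c0 s1 by simp
    \<comment> \<open>Here M = p^2 + e and e S^2 = 1, so 1 - M S^2 is minus a square.\<close>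
    have "C\<^sup>2 = - (p\<^sup>2 * S\<^sup>2)" using cv sh s1 D0 by algebra
    then have "C = 0"
      by (metis neg_le_0_iff_le mult_nonneg_nonneg zero_le_power2 order_antisym zero_eq_power2)
    with D0 sh show False by simp
  qed
  moreover have "c\<^sup>2 + D\<^sup>2 * s\<^sup>2 \<ge> 0" by simp
  ultimately show ?thesis using eq by linarith
qed

text \<open>Clearing the denominator turns both equations of the curve into polynomial identities
  modulo the relations, as for sn, cn, dn of a sum.\<close>

lemma add_map_curve:
  assumes "x \<in> add_curve e M" "S \<in> add_shifts e M" "e \<ge> 0"
  shows "add_map e S x \<in> add_curve e M"
proof -
  obtain s c p where x: "x = (s, c, p)" by (cases x)
  obtain T C D where S: "S = (T, C, D)" by (cases S)
  have cv: "s\<^sup>2 + c\<^sup>2 = 1" "p\<^sup>2 + e * s\<^sup>2 = M" using assms(1) x by (auto simp: add_curve_def)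
  have sh: "C\<^sup>2 + M * T\<^sup>2 = 1" "D\<^sup>2 + e * T\<^sup>2 = 1"
    using assms(2) S by (auto simp: add_shifts_def)
  define d where "d = 1 - e * T\<^sup>2 * s\<^sup>2"
  have d: "d \<noteq> 0" using add_denominator_pos[of s c p e M T C D] assms x S by (auto simp: d_def)
  have "(s * C * D + T * c * p)\<^sup>2 + (c * C - T * s * p * D)\<^sup>2 = d\<^sup>2"
    using cv sh d_def by algebra
  moreover have "(p * D - e * T * s * c * C)\<^sup>2 + e * (s * C * D + T * c * p)\<^sup>2 = M * d\<^sup>2"
    using cv sh d_def by algebra
  ultimately show ?thesis
    using d unfolding x S add_map.simps d_def[symmetric] add_curve_def
    by (simp add: power_divide add_divide_distrib[symmetric])
qed

text \<open>
  Modulo the relations, the composite of two additions is linear in the products of the square roots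
  \<open>c, p, C, D, G, H\<close>. Passing to this normal form before comparing the two orders of composition keeps
  the polynomial identities small.
\<close>

lemma add_twice_normal_form:
  fixes s c p e M S C D T G H :: real
  assumes rel: "c\<^sup>2 = 1 - s\<^sup>2" "p\<^sup>2 = M - e * s\<^sup>2" "C\<^sup>2 = 1 - M * S\<^sup>2" "D\<^sup>2 = 1 - e * S\<^sup>2"
  defines "d \<equiv> 1 - e * S\<^sup>2 * s\<^sup>2"
    and "u \<equiv> s * C * D + S * c * p" and "v \<equiv> c * C - S * s * p * D"
    and "w \<equiv> p * D - e * S * s * c * C"
  shows "d\<^sup>2 - e * T\<^sup>2 * u\<^sup>2 = d\<^sup>2 - e * T\<^sup>2 * (s\<^sup>2 * (1 - M * S\<^sup>2) * (1 - e * S\<^sup>2)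
      + S\<^sup>2 * (1 - s\<^sup>2) * (M - e * s\<^sup>2) + 2 * s * S * (c * p * (C * D)))"
    and "d * u * G * H + T * v * w = d * s * (C * D * (G * H)) + d * S * (c * p * (G * H))
      + T * (1 + e * S\<^sup>2 * s\<^sup>2) * (c * p * (C * D))
      - T * S * s * ((M - e * s\<^sup>2) * (1 - e * S\<^sup>2) + e * (1 - s\<^sup>2) * (1 - M * S\<^sup>2))"
    and "d * v * G - T * u * w * H = d * (c * C * G) - d * S * s * (p * D * G)
      - T * s * (1 - 2 * e * S\<^sup>2 + e * S\<^sup>2 * s\<^sup>2) * (p * C * H)
      - T * S * (M + e * M * S\<^sup>2 * s\<^sup>2 - 2 * e * s\<^sup>2) * (c * D * H)"
    and "d * w * H - e * T * u * v * G = d * (p * D * H) - d * e * S * s * (c * C * H)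
      - e * T * s * (1 - 2 * M * S\<^sup>2 + e * S\<^sup>2 * s\<^sup>2) * (c * D * G)
      - e * T * S * (1 - 2 * s\<^sup>2 + e * S\<^sup>2 * s\<^sup>2) * (p * C * G)"
  unfolding d_def u_def v_def w_def using rel by algebra+

text \<open>For the first components of the two composites, cross-multiplied. The square roots enter
  only through x = c p, X = C D, Y = G H, so the three squares are enough.\<close>

lemma add_twice_symmetric_s:
  fixes s x X Y e M S T :: real
  assumes "x\<^sup>2 = (1 - s\<^sup>2) * (M - e * s\<^sup>2)" "X\<^sup>2 = (1 - M * S\<^sup>2) * (1 - e * S\<^sup>2)"
    "Y\<^sup>2 = (1 - M * T\<^sup>2) * (1 - e * T\<^sup>2)"
  shows "((1 - e * S\<^sup>2 * s\<^sup>2) * s * (X * Y) + (1 - e * S\<^sup>2 * s\<^sup>2) * S * (x * Y)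
      + T * (1 + e * S\<^sup>2 * s\<^sup>2) * (x * X)
      - T * S * s * ((M - e * s\<^sup>2) * (1 - e * S\<^sup>2) + e * (1 - s\<^sup>2) * (1 - M * S\<^sup>2))) *
    ((1 - e * T\<^sup>2 * s\<^sup>2)\<^sup>2 - e * S\<^sup>2 * (s\<^sup>2 * (1 - M * T\<^sup>2) * (1 - e * T\<^sup>2)
      + T\<^sup>2 * (1 - s\<^sup>2) * (M - e * s\<^sup>2) + 2 * s * T * (x * Y))) =
    ((1 - e * T\<^sup>2 * s\<^sup>2) * s * (Y * X) + (1 - e * T\<^sup>2 * s\<^sup>2) * T * (x * X)
      + S * (1 + e * T\<^sup>2 * s\<^sup>2) * (x * Y)
      - S * T * s * ((M - e * s\<^sup>2) * (1 - e * T\<^sup>2) + e * (1 - s\<^sup>2) * (1 - M * T\<^sup>2))) *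
    ((1 - e * S\<^sup>2 * s\<^sup>2)\<^sup>2 - e * T\<^sup>2 * (s\<^sup>2 * (1 - M * S\<^sup>2) * (1 - e * S\<^sup>2)
      + S\<^sup>2 * (1 - s\<^sup>2) * (M - e * s\<^sup>2) + 2 * s * S * (x * X)))"
  using assms by algebra

text \<open>For the second components: f1, f2, f3, f4 stand for c C G, p D G, p C H, c D H, and y, z
  for c p C D, c p G H. Multiplication by y or z permutes the f's up to polynomial factors;
  exchanging the two shifts swaps f2 with f3.\<close>

lemma add_twice_symmetric_c:
  fixes s e M S T f1 f2 f3 f4 y z :: real
  assumes "y * f1 = (1 - s\<^sup>2) * (1 - M * S\<^sup>2) * f2" "y * f2 = (M - e * s\<^sup>2) * (1 - e * S\<^sup>2) * f1"
    "y * f3 = (M - e * s\<^sup>2) * (1 - M * S\<^sup>2) * f4" "y * f4 = (1 - s\<^sup>2) * (1 - e * S\<^sup>2) * f3"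
    and "z * f1 = (1 - s\<^sup>2) * (1 - M * T\<^sup>2) * f3" "z * f3 = (M - e * s\<^sup>2) * (1 - e * T\<^sup>2) * f1"
    "z * f2 = (M - e * s\<^sup>2) * (1 - M * T\<^sup>2) * f4" "z * f4 = (1 - s\<^sup>2) * (1 - e * T\<^sup>2) * f2"
  shows "((1 - e * S\<^sup>2 * s\<^sup>2) * f1 - (1 - e * S\<^sup>2 * s\<^sup>2) * S * s * f2
      - T * s * (1 - 2 * e * S\<^sup>2 + e * S\<^sup>2 * s\<^sup>2) * f3
      - T * S * (M + e * M * S\<^sup>2 * s\<^sup>2 - 2 * e * s\<^sup>2) * f4) *
    ((1 - e * T\<^sup>2 * s\<^sup>2)\<^sup>2 - e * S\<^sup>2 * (s\<^sup>2 * (1 - M * T\<^sup>2) * (1 - e * T\<^sup>2)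
      + T\<^sup>2 * (1 - s\<^sup>2) * (M - e * s\<^sup>2) + 2 * s * T * z)) =
    ((1 - e * T\<^sup>2 * s\<^sup>2) * f1 - (1 - e * T\<^sup>2 * s\<^sup>2) * T * s * f3
      - S * s * (1 - 2 * e * T\<^sup>2 + e * T\<^sup>2 * s\<^sup>2) * f2
      - S * T * (M + e * M * T\<^sup>2 * s\<^sup>2 - 2 * e * s\<^sup>2) * f4) *
    ((1 - e * S\<^sup>2 * s\<^sup>2)\<^sup>2 - e * T\<^sup>2 * (s\<^sup>2 * (1 - M * S\<^sup>2) * (1 - e * S\<^sup>2)
      + S\<^sup>2 * (1 - s\<^sup>2) * (M - e * s\<^sup>2) + 2 * s * S * y))"
  using assms by algebra

text \<open>For the third components: f1, f2, f3, f4 stand for p D H, c C H, c D G, p C G, with y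
  and z as for the second.\<close>

lemma add_twice_symmetric_p:
  fixes s e M S T f1 f2 f3 f4 y z :: real
  assumes "y * f1 = (M - e * s\<^sup>2) * (1 - e * S\<^sup>2) * f2" "y * f2 = (1 - s\<^sup>2) * (1 - M * S\<^sup>2) * f1"
    "y * f3 = (1 - s\<^sup>2) * (1 - e * S\<^sup>2) * f4" "y * f4 = (M - e * s\<^sup>2) * (1 - M * S\<^sup>2) * f3"
    and "z * f1 = (M - e * s\<^sup>2) * (1 - e * T\<^sup>2) * f3" "z * f3 = (1 - s\<^sup>2) * (1 - M * T\<^sup>2) * f1"
    "z * f2 = (1 - s\<^sup>2) * (1 - e * T\<^sup>2) * f4" "z * f4 = (M - e * s\<^sup>2) * (1 - M * T\<^sup>2) * f2"
  shows "((1 - e * S\<^sup>2 * s\<^sup>2) * f1 - (1 - e * S\<^sup>2 * s\<^sup>2) * e * S * s * f2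
      - e * T * s * (1 - 2 * M * S\<^sup>2 + e * S\<^sup>2 * s\<^sup>2) * f3
      - e * T * S * (1 - 2 * s\<^sup>2 + e * S\<^sup>2 * s\<^sup>2) * f4) *
    ((1 - e * T\<^sup>2 * s\<^sup>2)\<^sup>2 - e * S\<^sup>2 * (s\<^sup>2 * (1 - M * T\<^sup>2) * (1 - e * T\<^sup>2)
      + T\<^sup>2 * (1 - s\<^sup>2) * (M - e * s\<^sup>2) + 2 * s * T * z)) =
    ((1 - e * T\<^sup>2 * s\<^sup>2) * f1 - (1 - e * T\<^sup>2 * s\<^sup>2) * e * T * s * f3
      - e * S * s * (1 - 2 * M * T\<^sup>2 + e * T\<^sup>2 * s\<^sup>2) * f2
      - e * S * T * (1 - 2 * s\<^sup>2 + e * T\<^sup>2 * s\<^sup>2) * f4) *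
    ((1 - e * S\<^sup>2 * s\<^sup>2)\<^sup>2 - e * T\<^sup>2 * (s\<^sup>2 * (1 - M * S\<^sup>2) * (1 - e * S\<^sup>2)
      + S\<^sup>2 * (1 - s\<^sup>2) * (M - e * s\<^sup>2) + 2 * s * S * y))"
  using assms by algebra

text \<open>Each composite is put over a single denominator, and the cross-multiplied components are
  compared in normal form. This is pure algebra, so it covers the degenerate curves as well.\<close>

lemma add_map_commute:
  assumes x: "x \<in> add_curve e M" and A: "A \<in> add_shifts e M" and B: "B \<in> add_shifts e M"
    and e: "e \<ge> 0"
  shows "add_map e A (add_map e B x) = add_map e B (add_map e A x)"
proof -
  obtain s c p where xe: "x = (s, c, p)" by (cases x)
  obtain S C D where Ae: "A = (S, C, D)" by (cases A)
  obtain T G H where Be: "B = (T, G, H)" by (cases B)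
  have rel: "c\<^sup>2 = 1 - s\<^sup>2" "p\<^sup>2 = M - e * s\<^sup>2" "C\<^sup>2 = 1 - M * S\<^sup>2" "D\<^sup>2 = 1 - e * S\<^sup>2"
    "G\<^sup>2 = 1 - M * T\<^sup>2" "H\<^sup>2 = 1 - e * T\<^sup>2"
    using x A B unfolding xe Ae Be add_curve_def add_shifts_def by (auto simp: algebra_simps)
  define d where "d = 1 - e * S\<^sup>2 * s\<^sup>2"
  define d' where "d' = 1 - e * T\<^sup>2 * s\<^sup>2"
  have d: "d \<noteq> 0" using add_denominator_pos x A e unfolding xe Ae d_def by fastforce
  have d': "d' \<noteq> 0" using add_denominator_pos x B e unfolding xe Be d'_def by fastforce
  define u where "u = s * C * D + S * c * p"
  define v where "v = c * C - S * s * p * D"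
  define w where "w = p * D - e * S * s * c * C"
  define u' where "u' = s * G * H + T * c * p"
  define v' where "v' = c * G - T * s * p * H"
  define w' where "w' = p * H - e * T * s * c * G"
  have Ax: "add_map e A x = (u / d, v / d, w / d)"
    unfolding xe Ae add_map.simps u_def v_def w_def d_def ..
  have Bx: "add_map e B x = (u' / d', v' / d', w' / d')"
    unfolding xe Be add_map.simps u'_def v'_def w'_def d'_def ..
  define k where "k = d\<^sup>2 - e * T\<^sup>2 * u\<^sup>2"
  define k' where "k' = d'\<^sup>2 - e * S\<^sup>2 * u'\<^sup>2"
  have kd: "1 - e * T\<^sup>2 * (u / d)\<^sup>2 = k / d\<^sup>2"
    using d by (simp add: k_def field_simps)
  have kd': "1 - e * S\<^sup>2 * (u' / d')\<^sup>2 = k' / d'\<^sup>2"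
    using d' by (simp add: k'_def field_simps)
  \<comment> \<open>The first sum lies on the curve again, so the positivity of denominators applies
    to it.\<close>
  have "1 - e * T\<^sup>2 * (u / d)\<^sup>2 \<noteq> 0"
    using add_denominator_pos[of "u / d" "v / d" "w / d" e M T G H] add_map_curve[OF x A e] B e
    unfolding Ax Be by simp
  then have k: "k \<noteq> 0" using kd by auto
  have "1 - e * S\<^sup>2 * (u' / d')\<^sup>2 \<noteq> 0"
    using add_denominator_pos[of "u' / d'" "v' / d'" "w' / d'" e M S C D] add_map_curve[OF x B e] A e
    unfolding Bx Ae by simp
  then have k': "k' \<noteq> 0" using kd' by auto
  have BA: "add_map e B (add_map e A x) =
      ((d * u * G * H + T * v * w) / k, (d * v * G - T * u * w * H) / k,
       (d * w * H - e * T * u * v * G) / k)"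
    unfolding Ax unfolding Be add_map.simps kd using d k by (simp add: field_simps power2_eq_square)
  have AB: "add_map e A (add_map e B x) =
      ((d' * u' * C * D + S * v' * w') / k', (d' * v' * C - S * u' * w' * D) / k',
       (d' * w' * D - e * S * u' * v' * C) / k')"
    unfolding Bx unfolding Ae add_map.simps kd' using d' k' by (simp add: field_simps power2_eq_square)
  note BAn = add_twice_normal_form[OF rel(1-4), folded u_def v_def w_def, folded d_def]
  note ABn = add_twice_normal_form[OF rel(1,2,5,6), folded u'_def v'_def w'_def, folded d'_def]
  have swap: "r * G * C = r * C * G" "r * H * C = r * C * H" "r * G * D = r * D * G"
    "r * H * D = r * D * H" for r
    by (simp_all only: mult_ac)
  have x2: "(c * p)\<^sup>2 = (1 - s\<^sup>2) * (M - e * s\<^sup>2)" "(C * D)\<^sup>2 = (1 - M * S\<^sup>2) * (1 - e * S\<^sup>2)"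
    "(G * H)\<^sup>2 = (1 - M * T\<^sup>2) * (1 - e * T\<^sup>2)"
    unfolding power_mult_distrib rel by (rule refl)+
  have "(d * u * G * H + T * v * w) * k' = (d' * u' * C * D + S * v' * w') * k"
    unfolding k_def k'_def BAn ABn unfolding d_def d'_def
    by (rule add_twice_symmetric_s[OF x2])
  \<comment> \<open>Written back with \<open>rel\<close>, every polynomial factor is the square of a
    root, and the hypotheses of \<open>add_twice_symmetric_c\<close> become identities of
    monomials.\<close>
  moreover have "(d * v * G - T * u * w * H) * k' = (d' * v' * C - S * u' * w' * D) * k"
    unfolding k_def k'_def BAn ABn unfolding d_def d'_def swap
    by (rule add_twice_symmetric_c; unfold rel[symmetric]; simp only: power2_eq_square mult_ac)
  moreover have "(d * w * H - e * T * u * v * G) * k' = (d' * w' * D - e * S * u' * v' * C) * k"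
    unfolding k_def k'_def BAn ABn unfolding d_def d'_def swap
    by (rule add_twice_symmetric_p; unfold rel[symmetric]; simp only: power2_eq_square mult_ac)
  ultimately show ?thesis unfolding AB BA using k k' by (simp add: frac_eq_eq)
qed

section \<open>The shift attached to an ellipse\<close>

text \<open>For a line with unit direction (s, c) leaving the ellipse at (x, y) this is the value of
  s x / a + c y / (a - e), written in terms of M.\<close>

definition joachimsthal_integral :: "real \<Rightarrow> real \<Rightarrow> real \<Rightarrow> real" where
  "joachimsthal_integral a e M = sqrt ((a - M) / (a * (a - e)))"

text \<open>
  Below, \<open>J\<close> is Joachimsthal's integral of the lines with invariant \<open>M\<close>; the shift is found by solving
  the addition formulas for the image of one line under the reflection.
\<close>

definition billiard_shift :: "real \<Rightarrow> real \<Rightarrow> real \<Rightarrow> real \<times> real \<times> real" where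
  "billiard_shift a e M =
     (let J = joachimsthal_integral a e M; d = M + a\<^sup>2 * J\<^sup>2
      in (- 2 * a * J / d, (M - a\<^sup>2 * J\<^sup>2) / d, (M - a\<^sup>2 * J\<^sup>2 + 2 * a * (a - e) * J\<^sup>2) / d))"

lemma joachimsthal_integral_sq:
  assumes "M \<le> a" "0 \<le> e" "e < a"
  shows "a * (a - e) * (joachimsthal_integral a e M)\<^sup>2 = a - M"
  using assms by (simp add: joachimsthal_integral_def)

text \<open>For M > 0 the first summand is positive. For M = 0 the integral satisfies (a - e) J^2 =
  1 and cannot vanish.\<close>

lemma shift_denominator_pos:
  assumes "0 \<le> M" "M \<le> a" "0 \<le> e" "e < a"
  shows "M + a\<^sup>2 * (joachimsthal_integral a e M)\<^sup>2 > 0"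
proof (cases "M = 0")
  case True
  have "a * (a - e) * (joachimsthal_integral a e M)\<^sup>2 = a"
    using joachimsthal_integral_sq[of M a e] assms True by simp
  then have "joachimsthal_integral a e M \<noteq> 0" using assms by auto
  then show ?thesis using True assms by auto
next
  case False
  then show ?thesis using assms by (intro add_pos_nonneg) auto
qed

text \<open>The first relation is (M - t^2)^2 + 4 M t^2 = (M + t^2)^2 with t = a J; the second also
  uses a (a - e) J^2 = a - M.\<close>

lemma billiard_shift_mem:
  assumes "0 \<le> M" "M \<le> a" "0 \<le> e" "e < a"
  shows "billiard_shift a e M \<in> add_shifts e M"
proof -
  define J where "J = joachimsthal_integral a e M"
  define d where "d = M + a\<^sup>2 * J\<^sup>2"
  have J: "a * (a - e) * J\<^sup>2 = a - M" using joachimsthal_integral_sq assms by (simp add: J_def)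
  have d: "d \<noteq> 0" using shift_denominator_pos assms by (force simp: J_def d_def)
  have "(M - a\<^sup>2 * J\<^sup>2)\<^sup>2 + M * (- 2 * a * J)\<^sup>2 = d\<^sup>2"
    unfolding d_def by algebra
  moreover have "(M - a\<^sup>2 * J\<^sup>2 + 2 * a * (a - e) * J\<^sup>2)\<^sup>2 + e * (- 2 * a * J)\<^sup>2 = d\<^sup>2"
    unfolding d_def using J by algebra
  \<comment> \<open>The two terms differ by 2 a (a - e) J^2, so both vanishing forces J = M = 0 and
    a zero denominator.\<close>
  moreover have "M - a\<^sup>2 * J\<^sup>2 \<noteq> 0 \<or> M - a\<^sup>2 * J\<^sup>2 + 2 * a * (a - e) * J\<^sup>2 \<noteq> 0"
  proof (rule ccontr)
    assume "\<not> ?thesis"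
    then have "J = 0" "M = 0" using assms by auto
    then show False using d by (simp add: d_def)
  qed
  ultimately show ?thesis
    using d unfolding billiard_shift_def Let_def J_def[symmetric] d_def[symmetric] add_shifts_def
    by (simp add: power_divide add_divide_distrib[symmetric])
qed

section \<open>Reflection in a tangent space\<close>

lemma closest_point_hyperplane:
  fixes n w :: "'a::euclidean_space"
  assumes "n \<noteq> 0"
  shows "closest_point {x. x \<bullet> n = 0} w = w - ((w \<bullet> n) / (n \<bullet> n)) *\<^sub>R n"
proof (rule closest_point_unique[symmetric])
  let ?q = "w - ((w \<bullet> n) / (n \<bullet> n)) *\<^sub>R n"
  show "convex {x. x \<bullet> n = 0}"
    using convex_hyperplane[of n 0] by (simp add: inner_commute)
  show "closed {x. x \<bullet> n = 0}"
    using closed_hyperplane[of n 0] by (simp add: inner_commute)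
  show q: "?q \<in> {x. x \<bullet> n = 0}" using assms by (simp add: inner_diff_left)
  show "\<forall>y\<in>{x. x \<bullet> n = 0}. dist w ?q \<le> dist w y"
  proof
    fix y assume "y \<in> {x. x \<bullet> n = 0}"
    then have y: "(?q - y) \<bullet> n = 0" using q by (simp add: inner_diff_left)
    \<comment> \<open>\<open>w - ?q\<close> is a multiple of \<open>n\<close>, hence orthogonal to
      \<open>?q - y\<close>.\<close>
    have "(dist w y)\<^sup>2 = (norm ((w - ?q) + (?q - y)))\<^sup>2" by (simp add: dist_norm)
    also have "\<dots> = (norm (w - ?q))\<^sup>2 + (norm (?q - y))\<^sup>2"
      using y by (subst norm_add_Pythagorean) (auto simp: orthogonal_def inner_commute)
    finally have "(dist w ?q)\<^sup>2 \<le> (dist w y)\<^sup>2" by (simp add: dist_norm)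
    then show "dist w ?q \<le> dist w y" by simp
  qed
qed

lemma reflect_in_hyperplane:
  fixes n w :: plane
  assumes "n \<noteq> 0"
  shows "reflect_in {x. x \<bullet> n = 0} w = w - (2 * (w \<bullet> n) / (n \<bullet> n)) *\<^sub>R n"
  unfolding reflect_in_def closest_point_hyperplane[OF assms]
  by (simp add: scaleR_2 scaleR_right_diff_distrib)

section \<open>Billiards in principal axes\<close>

text \<open>\<open>z\<close> serves as the common centre and \<open>u\<close> as the unit vector
  along the focal axis; \<open>v\<close> is \<open>u\<close> turned by a right angle.\<close>

locale plane_frame =
  fixes z u :: plane
  assumes norm_u: "norm u = 1"
begin

definition v :: plane where "v = vector [- (u $ 2), u $ 1]"
definition dir :: "real \<Rightarrow> real \<Rightarrow> plane" where "dir s c = s *\<^sub>R u + c *\<^sub>R v"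
definition cx :: "plane \<Rightarrow> real" where "cx Y = (Y - z) \<bullet> u"
definition cy :: "plane \<Rightarrow> real" where "cy Y = (Y - z) \<bullet> v"
definition ellipse :: "real \<Rightarrow> real \<Rightarrow> plane set" where
  "ellipse a b = {Y. b * (cx Y)\<^sup>2 + a * (cy Y)\<^sup>2 = a * b}"

fun line :: "real \<times> real \<times> real \<Rightarrow> oriented_line" where
  "line (s, c, p) = ({Y. cx Y * c - cy Y * s = p}, dir s c)"

lemma frame_inner: "u \<bullet> u = 1" "v \<bullet> v = 1" "u \<bullet> v = 0" "v \<bullet> u = 0"
proof -
  show "u \<bullet> u = 1" using norm_u by (simp add: dot_square_norm)
  then show "v \<bullet> v = 1" "u \<bullet> v = 0" "v \<bullet> u = 0"
    by (auto simp: v_def inner_vec_def sum_2)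
qed

lemma dir_components: "dir (w \<bullet> u) (w \<bullet> v) = w"
proof -
  have n: "u $ 1 * u $ 1 + u $ 2 * u $ 2 = 1"
    using frame_inner(1) by (simp add: inner_vec_def sum_2)
  have "(w $ 1 * u $ 1 + w $ 2 * u $ 2) * u $ 1 - (w $ 2 * u $ 1 - w $ 1 * u $ 2) * u $ 2 = w $ 1"
    using n by algebra
  moreover have "(w $ 1 * u $ 1 + w $ 2 * u $ 2) * u $ 2 + (w $ 2 * u $ 1 - w $ 1 * u $ 2) * u $ 1 = w $ 2"
    using n by algebra
  ultimately show ?thesis
    by (simp add: dir_def v_def vec_eq_iff forall_2 inner_vec_def sum_2)
qed

lemma inner_dir: "dir s c \<bullet> dir s' c' = s * s' + c * c'"
  by (simp add: dir_def inner_add_left inner_add_right frame_inner)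

lemma dir_inner_frame: "dir s c \<bullet> u = s" "dir s c \<bullet> v = c"
  by (simp_all add: dir_def inner_add_left frame_inner)

lemma dir_eq_0_iff: "dir s c = 0 \<longleftrightarrow> s = 0 \<and> c = 0"
  by (metis dir_inner_frame inner_zero_left dir_def add_0 scaleR_zero_left)

lemma point_eqI: "cx X = cx Y \<Longrightarrow> cy X = cy Y \<Longrightarrow> X = Y"
  using dir_components[of "X - z"] dir_components[of "Y - z"]
  by (metis cx_def cy_def diff_add_cancel)

lemma coord_point [simp]: "cx (z + dir x y) = x" "cy (z + dir x y) = y"
  by (simp_all add: cx_def cy_def dir_inner_frame)

lemma coord_shift: "cx (X + t *\<^sub>R dir s c) = cx X + t * s" "cy (X + t *\<^sub>R dir s c) = cy X + t * c"
  by (simp_all add: cx_def cy_def inner_diff_left inner_add_left dir_inner_frame)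

lemma inner_coord: "X \<bullet> dir s c = z \<bullet> dir s c + cx X * s + cy X * c"
  by (simp add: cx_def cy_def dir_def inner_diff_left inner_add_right algebra_simps)

lemma oriented_line_through_eq:
  assumes "s\<^sup>2 + c\<^sup>2 = 1"
  shows "oriented_line_through X (dir s c) = line (s, c, cx X * c - cy X * s)"
proof -
  have "Y \<in> range (\<lambda>t. X + t *\<^sub>R dir s c)" if Y: "cx Y * c - cy Y * s = cx X * c - cy X * s" for Y
  proof
    define t where "t = (cx Y - cx X) * s + (cy Y - cy X) * c"
    have "cx Y = cx X + t * s" "cy Y = cy X + t * c"
      using Y assms unfolding t_def by algebra+
    then show "Y = X + t *\<^sub>R dir s c" by (intro point_eqI) (simp_all add: coord_shift)
  qed simp
  moreover have "cx Y * c - cy Y * s = cx X * c - cy X * s"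
    if Y: "Y \<in> range (\<lambda>t. X + t *\<^sub>R dir s c)" for Y
    using Y by (auto simp: coord_shift algebra_simps)
  ultimately have "range (\<lambda>t. X + t *\<^sub>R dir s c) = {Y. cx Y * c - cy Y * s = cx X * c - cy X * s}"
    by blast
  then show ?thesis by (simp add: oriented_line_through_def)
qed

lemma oriented_lines_eq: "oriented_lines = {line (s, c, p) | s c p. s\<^sup>2 + c\<^sup>2 = 1}"
proof (intro equalityI subsetI)
  fix l assume "l \<in> oriented_lines"
  then obtain X w where l: "l = oriented_line_through X w" and w: "norm w = 1"
    by (auto simp: oriented_lines_def)
  define s c where "s = w \<bullet> u" and "c = w \<bullet> v"
  have wd: "w = dir s c" using dir_components[of w] by (simp add: s_def c_def)
  have "dir s c \<bullet> dir s c = 1" using w wd by (simp add: dot_square_norm)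
  then have "s\<^sup>2 + c\<^sup>2 = 1" by (simp add: inner_dir power2_eq_square)
  then show "l \<in> {line (s, c, p) | s c p. s\<^sup>2 + c\<^sup>2 = 1}"
    using l wd oriented_line_through_eq by blast
next
  fix l assume "l \<in> {line (s, c, p) | s c p. s\<^sup>2 + c\<^sup>2 = 1}"
  then obtain s c p where l: "l = line (s, c, p)" and sc: "s\<^sup>2 + c\<^sup>2 = 1" by auto
  have "p * c * c - (- p * s) * s = p" using sc by algebra
  \<comment> \<open>The base point is the foot of the perpendicular from \<open>z\<close>.\<close>
  then have "l = oriented_line_through (z + dir (p * c) (- p * s)) (dir s c)"
    using oriented_line_through_eq[OF sc] l by simp
  moreover have "norm (dir s c) = 1"
    using sc by (simp add: norm_eq_sqrt_inner inner_dir power2_eq_square)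
  ultimately show "l \<in> oriented_lines" by (auto simp: oriented_lines_def)
qed

section \<open>Tangents and reflection at the exit point\<close>

text \<open>One inclusion differentiates the equation of the ellipse along a curve. For the other,
  an explicit motion on the ellipse realises each velocity orthogonal to the gradient.\<close>

lemma tangent_space_ellipse:
  assumes a: "a > 0" and b: "b > 0" and X: "X \<in> ellipse a b"
  shows "tangent_space (ellipse a b) X = {w. w \<bullet> dir (b * cx X) (a * cy X) = 0}"
proof (intro equalityI subsetI)
  fix w assume "w \<in> tangent_space (ellipse a b) X"
  then obtain g :: "real \<Rightarrow> plane" where g: "range g \<subseteq> ellipse a b" "g 0 = X"
    and D: "(g has_vector_derivative w) (at 0)"
    by (auto simp: tangent_space_def)
  have Dl: "((\<lambda>t. (g t - z) \<bullet> n) has_real_derivative (w \<bullet> n)) (at 0)" for n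
  proof -
    have "((\<lambda>t. (g t - z) \<bullet> n) has_vector_derivative (w \<bullet> n)) (at 0)"
      by (rule bounded_linear.has_vector_derivative[OF bounded_linear_inner_left])
        (auto intro!: derivative_eq_intros D)
    then show ?thesis by (simp add: has_real_derivative_iff_has_vector_derivative)
  qed
  have "((\<lambda>t. b * (cx (g t))\<^sup>2 + a * (cy (g t))\<^sup>2) has_real_derivative
      (b * (2 * cx X * (w \<bullet> u)) + a * (2 * cy X * (w \<bullet> v)))) (at 0)"
    unfolding cx_def cy_def using g(2) by (auto intro!: derivative_eq_intros Dl)
  moreover have "(\<lambda>t. b * (cx (g t))\<^sup>2 + a * (cy (g t))\<^sup>2) = (\<lambda>t. a * b)"
    using g(1) by (auto simp: ellipse_def)
  ultimately have "b * (2 * cx X * (w \<bullet> u)) + a * (2 * cy X * (w \<bullet> v)) = 0"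
    using DERIV_unique[OF _ DERIV_const] by metis
  then show "w \<in> {w. w \<bullet> dir (b * cx X) (a * cy X) = 0}"
    by (simp add: dir_def inner_add_right algebra_simps)
next
  fix w assume "w \<in> {w. w \<bullet> dir (b * cx X) (a * cy X) = 0}"
  then have w: "(w \<bullet> u) * (b * cx X) + (w \<bullet> v) * (a * cy X) = 0"
    by (simp add: dir_def inner_add_right algebra_simps)
  define x y where "x = cx X" and "y = cy X"
  have E: "b * x\<^sup>2 + a * y\<^sup>2 = a * b" using X by (simp add: ellipse_def x_def y_def)
  define r where "r = sqrt (a * b)"
  have r: "r\<^sup>2 = a * b" "r \<noteq> 0" using a b by (auto simp: r_def)
  define N where "N = (b * x)\<^sup>2 + (a * y)\<^sup>2"
  have N: "N \<noteq> 0"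
  proof
    assume "N = 0"
    then have "x = 0" "y = 0" using a b by (auto simp: N_def add_nonneg_eq_0_iff)
    then show False using E a b by simp
  qed
  define l where "l = (b * x * (w \<bullet> v) - a * y * (w \<bullet> u)) / N"
  have wl: "w \<bullet> u = - l * (a * y)" "w \<bullet> v = l * (b * x)"
  proof -
    have "(w \<bullet> u) * N = - (b * x * (w \<bullet> v) - a * y * (w \<bullet> u)) * (a * y)"
      using w unfolding N_def x_def y_def by algebra
    then show "w \<bullet> u = - l * (a * y)" using N by (simp add: l_def field_simps)
    have "(w \<bullet> v) * N = (b * x * (w \<bullet> v) - a * y * (w \<bullet> u)) * (b * x)"
      using w unfolding N_def x_def y_def by algebra
    then show "w \<bullet> v = l * (b * x)" using N by (simp add: l_def field_simps)
  qed
  \<comment> \<open>The affine image of a uniform rotation: in x = sqrt a cos, y = sqrt b sin the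
    angle advances by l r t, which gives the velocity (- l a y, l b x) at time 0.\<close>
  define g where "g t = z + dir (x * cos (l * r * t) - a * y / r * sin (l * r * t))
    (y * cos (l * r * t) + b * x / r * sin (l * r * t))" for t
  have "range g \<subseteq> ellipse a b"
  proof (rule image_subsetI)
    fix t
    define C S where "C = cos (l * r * t)" and "S = sin (l * r * t)"
    define q where "q = 1 / r"
    have CS: "C\<^sup>2 + S\<^sup>2 = 1" by (simp add: C_def S_def)
    have q: "q\<^sup>2 * (a * b) = 1" using r a b by (simp add: q_def power_divide)
    have "b * (x * C - a * y * q * S)\<^sup>2 + a * (y * C + b * x * q * S)\<^sup>2 =
        (b * x\<^sup>2 + a * y\<^sup>2) * (C\<^sup>2 + q\<^sup>2 * (a * b) * S\<^sup>2)" by algebra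
    also have "\<dots> = a * b" unfolding E q using CS by simp
    finally have "b * (x * C - a * y * q * S)\<^sup>2 + a * (y * C + b * x * q * S)\<^sup>2 = a * b" .
    then show "g t \<in> ellipse a b" by (simp add: ellipse_def g_def C_def S_def q_def)
  qed
  moreover have "g 0 = X" by (rule point_eqI) (simp_all add: g_def x_def y_def)
  moreover have "(g has_vector_derivative w) (at 0)"
  proof -
    have "((\<lambda>t. x * cos (l * r * t) - a * y / r * sin (l * r * t))
        has_vector_derivative (- l * (a * y))) (at 0)"
      unfolding has_real_derivative_iff_has_vector_derivative[symmetric]
      by (auto intro!: derivative_eq_intros simp: r(2))
    moreover have "((\<lambda>t. y * cos (l * r * t) + b * x / r * sin (l * r * t))
        has_vector_derivative (l * (b * x))) (at 0)"
      unfolding has_real_derivative_iff_has_vector_derivative[symmetric]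
      by (auto intro!: derivative_eq_intros simp: r(2))
    ultimately have "(g has_vector_derivative (0 + dir (- l * (a * y)) (l * (b * x)))) (at 0)"
      unfolding g_def dir_def
      by (intro has_vector_derivative_add has_vector_derivative_const
          bounded_linear.has_vector_derivative[OF bounded_linear_scaleR_left])
    moreover have "dir (- l * (a * y)) (l * (b * x)) = w"
      using dir_components[of w] unfolding wl .
    ultimately show ?thesis by simp
  qed
  ultimately show "w \<in> tangent_space (ellipse a b) X"
    unfolding tangent_space_def by (intro CollectI exI[of _ g] conjI)
qed

text \<open>Substituting the line into the ellipse gives a quadratic equation for the position along
  the line; here its square is completed.\<close>

lemma line_meets_ellipseD:
  assumes a: "a > 0" and b: "b > 0" and sc: "s\<^sup>2 + c\<^sup>2 = 1"
    and Y: "Y \<in> fst (line (s, c, p))" "Y \<in> ellipse a b"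
  shows "((b * s\<^sup>2 + a * c\<^sup>2) * (cx Y * s + cy Y * c) - (a - b) * p * s * c)\<^sup>2
    = a * b * (b * s\<^sup>2 + a * c\<^sup>2 - p\<^sup>2)"
proof -
  define w where "w = cx Y * s + cy Y * c"
  have p: "cx Y * c - cy Y * s = p" and E: "b * (cx Y)\<^sup>2 + a * (cy Y)\<^sup>2 = a * b"
    using Y by (auto simp: ellipse_def)
  have "cx Y = w * s + p * c" using sc unfolding w_def p[symmetric] by algebra
  moreover have "cy Y = w * c - p * s" using sc unfolding w_def p[symmetric] by algebra
  ultimately have E': "b * (w * s + p * c)\<^sup>2 + a * (w * c - p * s)\<^sup>2 = a * b" using E by simp
  have "((b * s\<^sup>2 + a * c\<^sup>2) * w - (a - b) * p * s * c)\<^sup>2 =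
      (b * s\<^sup>2 + a * c\<^sup>2) * (b * (w * s + p * c)\<^sup>2 + a * (w * c - p * s)\<^sup>2)
        - a * b * p\<^sup>2 * (s\<^sup>2 + c\<^sup>2)\<^sup>2"
    by algebra
  then show ?thesis unfolding E' sc w_def[symmetric] by (simp add: algebra_simps)
qed

text \<open>
  Here \<open>(n1, n2)\<close> is the outer normal at the exit point \<open>X\<close>, scaled so that its inner product with the
  direction of the line is \<open>J * q\<close>.
\<close>

lemma billiard_map_line:
  assumes b: "b > 0" and ab: "b \<le> a" and sc: "s\<^sup>2 + c\<^sup>2 = 1"
    and J: "a * b * J\<^sup>2 = b * s\<^sup>2 + a * c\<^sup>2 - p\<^sup>2" "J \<ge> 0"
  defines "n1 \<equiv> p * c + b * J * s" and "n2 \<equiv> a * J * c - p * s"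
    and "q \<equiv> b * s\<^sup>2 + a * c\<^sup>2"
  defines "X \<equiv> z + dir (a * n1 / q) (b * n2 / q)"
  shows "X \<in> fst (line (s, c, p)) \<inter> ellipse a b" "n1\<^sup>2 + n2\<^sup>2 \<noteq> 0"
    "billiard_map (ellipse a b) (line (s, c, p)) =
       line (s - 2 * J * q / (n1\<^sup>2 + n2\<^sup>2) * n1, c - 2 * J * q / (n1\<^sup>2 + n2\<^sup>2) * n2,
         p - 2 * J * (a - b) / (n1\<^sup>2 + n2\<^sup>2) * n1 * n2)"
proof -
  have a: "a > 0" using b ab by simp
  have q: "q > 0"
  proof -
    have "q = b + (a - b) * c\<^sup>2" using sc unfolding q_def by algebra
    then show ?thesis using b ab by (simp add: add_pos_nonneg)
  qed
  have "a * n1 * c - b * n2 * s = p * q"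
    unfolding n1_def n2_def q_def by algebra
  then have Xl: "X \<in> fst (line (s, c, p))"
    using q by (simp add: X_def diff_divide_distrib[symmetric] field_simps)
  have "b * (a * n1)\<^sup>2 + a * (b * n2)\<^sup>2 = a * b * q\<^sup>2"
    using sc J(1) unfolding n1_def n2_def q_def by algebra
  then have XE: "X \<in> ellipse a b"
    using q by (simp add: X_def ellipse_def power_divide add_divide_distrib[symmetric])
  show X: "X \<in> fst (line (s, c, p)) \<inter> ellipse a b" using Xl XE by blast
  show nn: "n1\<^sup>2 + n2\<^sup>2 \<noteq> 0"
  proof
    assume "n1\<^sup>2 + n2\<^sup>2 = 0"
    then have "n1 = 0" "n2 = 0" by auto
    then have "cx X = 0" "cy X = 0" by (simp_all add: X_def)
    then show False using XE a b by (simp add: ellipse_def)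
  qed
  have Xw: "q * (cx X * s + cy X * c) = a * b * J + (a - b) * p * s * c"
  proof -
    have "a * n1 * s + b * n2 * c = a * b * J + (a - b) * p * s * c"
      using sc unfolding n1_def n2_def by algebra
    moreover have "q * (cx X * s + cy X * c) = a * n1 * s + b * n2 * c"
      using q by (simp add: X_def distrib_left)
    ultimately show ?thesis by simp
  qed
  \<comment> \<open>The positions of the common points solve that quadratic, and since J >= 0 the
    point X takes the larger root.\<close>
  have max: "Y \<bullet> dir s c \<le> X \<bullet> dir s c" if Y: "Y \<in> fst (line (s, c, p)) \<inter> ellipse a b" for Y
  proof -
    have "(q * (cx Y * s + cy Y * c) - (a - b) * p * s * c)\<^sup>2 = a * b * (a * b * J\<^sup>2)"
      unfolding J(1) q_def by (rule line_meets_ellipseD[OF a b sc IntD1[OF Y] IntD2[OF Y]])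
    also have "\<dots> = (a * b * J)\<^sup>2" by (simp add: power2_eq_square)
    finally have "q * (cx Y * s + cy Y * c) - (a - b) * p * s * c \<le> a * b * J"
      by (rule power2_le_imp_le[OF eq_refl]) (use a b J(2) in simp)
    then have "q * (cx Y * s + cy Y * c) \<le> q * (cx X * s + cy X * c)"
      unfolding Xw by (simp only: diff_le_eq)
    then show ?thesis using q by (simp add: inner_coord[of X] inner_coord[of Y])
  qed
  have exit: "exit_point (ellipse a b) (line (s, c, p)) = X"
  proof -
    let ?P = "\<lambda>Y. Y \<in> fst (line (s, c, p)) \<inter> ellipse a b"
    \<comment> \<open>\<open>arg_max\<close> picks some maximiser; a point of the line is determined
      by its position along it, so the choice must be X.\<close>
    define Z where "Z = arg_max (\<lambda>Y. Y \<bullet> dir s c) ?P"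
    have "is_arg_max (\<lambda>Y. Y \<bullet> dir s c) ?P X"
      using X max by (simp add: is_arg_max_linorder)
    then have Z: "is_arg_max (\<lambda>Y. Y \<bullet> dir s c) ?P Z"
      unfolding Z_def arg_max_def by (rule someI)
    then have eq: "Z \<bullet> dir s c = X \<bullet> dir s c" and Zl: "cx Z * c - cy Z * s = p"
      using X max by (auto simp: is_arg_max_linorder intro!: antisym)
    have "cx Z * s + cy Z * c = cx X * s + cy X * c" 
      using eq by (simp add: inner_coord[of X] inner_coord[of Z])
    moreover have "cx X * c - cy X * s = p" using Xl by simp
    ultimately have "cx Z = cx X" "cy Z = cy X" using Zl sc by algebra+
    then have "Z = X" by (rule point_eqI)
    then show ?thesis by (simp add: exit_point_def arg_max_on_def Z_def)
  qed
  define n where "n = dir n1 n2"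
  have n0: "n \<noteq> 0" using nn by (auto simp: n_def dir_eq_0_iff)
  have T: "tangent_space (ellipse a b) X = {w. w \<bullet> n = 0}"
  proof -
    have "dir (b * cx X) (a * cy X) = (a * b / q) *\<^sub>R n"
      unfolding X_def coord_point n_def by (simp add: dir_def scaleR_add_right mult_ac)
    then show ?thesis unfolding tangent_space_ellipse[OF a b XE] using a b q by simp
  qed
  have un: "s * n1 + c * n2 = J * q" unfolding n1_def n2_def q_def by algebra
  define k where "k = 2 * J * q / (n1\<^sup>2 + n2\<^sup>2)"
  have R: "reflect_in {w. w \<bullet> n = 0} (dir s c) = dir (s - k * n1) (c - k * n2)"
    unfolding reflect_in_hyperplane[OF n0] using un
    by (simp add: n_def inner_dir k_def power2_eq_square[symmetric] mult.assoc)
      (simp add: dir_def algebra_simps)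
  have unit: "(s - k * n1)\<^sup>2 + (c - k * n2)\<^sup>2 = 1"
  proof -
    have "k * (n1\<^sup>2 + n2\<^sup>2) = 2 * (s * n1 + c * n2)" using nn un by (simp add: k_def)
    then show ?thesis using sc by algebra
  qed
  have "billiard_map (ellipse a b) (line (s, c, p)) =
      line (s - k * n1, c - k * n2, cx X * (c - k * n2) - cy X * (s - k * n1))"
    unfolding billiard_map_def Let_def exit T using oriented_line_through_eq[OF unit, of X] R by simp
  moreover have "cx X * (c - k * n2) - cy X * (s - k * n1) =
      p - 2 * J * (a - b) / (n1\<^sup>2 + n2\<^sup>2) * n1 * n2"
  proof -
    have "cx X * c - cy X * s = p" using Xl by simp
    then have "cx X * (c - k * n2) - cy X * (s - k * n1) = p - k * (cx X * n2 - cy X * n1)"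
      by (simp add: algebra_simps)
    also have "cx X * n2 - cy X * n1 = (a - b) * n1 * n2 / q"
      by (simp add: X_def diff_divide_distrib[symmetric] algebra_simps)
    finally show ?thesis using q by (simp add: k_def)
  qed
  ultimately show "billiard_map (ellipse a b) (line (s, c, p)) =
       line (s - 2 * J * q / (n1\<^sup>2 + n2\<^sup>2) * n1, c - 2 * J * q / (n1\<^sup>2 + n2\<^sup>2) * n2,
         p - 2 * J * (a - b) / (n1\<^sup>2 + n2\<^sup>2) * n1 * n2)"
    by (simp add: k_def)
qed

section \<open>Reflection as a translation of the invariant curves\<close>

text \<open>On the curve the discriminant term b s^2 + a c^2 - p^2, with b = a - e, equals a - M. A
  common point makes it nonnegative; conversely, if it is nonnegative then J is defined by a genuine
  root and yields the exit point.\<close>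

lemma line_meets_ellipse_iff:
  assumes e: "0 \<le> e" "e < a" and x: "x \<in> add_curve e M"
  shows "fst (line x) \<inter> ellipse a (a - e) \<noteq> {} \<longleftrightarrow> M \<le> a"
proof -
  obtain s c p where xe: "x = (s, c, p)" by (cases x)
  have cv: "s\<^sup>2 + c\<^sup>2 = 1" "p\<^sup>2 + e * s\<^sup>2 = M" using x by (auto simp: xe add_curve_def)
  have q: "(a - e) * s\<^sup>2 + a * c\<^sup>2 - p\<^sup>2 = a - M" using cv by algebra
  have pos: "a > 0" "a - e > 0" "a - e \<le> a" using e by auto
  show ?thesis
  proof
    assume "fst (line x) \<inter> ellipse a (a - e) \<noteq> {}"
    then obtain Y where "Y \<in> fst (line (s, c, p))" "Y \<in> ellipse a (a - e)" using xe by auto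
    from line_meets_ellipseD[OF pos(1,2) cv(1) this] have "a * (a - e) * (a - M) \<ge> 0"
      unfolding q using zero_le_power2 by metis
    moreover have "a * (a - e) > 0" using pos by simp
    ultimately have "a - M \<ge> 0" using zero_le_mult_iff linorder_not_le by metis
    then show "M \<le> a" by simp
  next
    assume "M \<le> a"
    then have J: "a * (a - e) * (joachimsthal_integral a e M)\<^sup>2 = (a - e) * s\<^sup>2 + a * c\<^sup>2 - p\<^sup>2"
      using joachimsthal_integral_sq e q by simp
    have J0: "joachimsthal_integral a e M \<ge> 0"
      using \<open>M \<le> a\<close> e by (simp add: joachimsthal_integral_def)
    show "fst (line x) \<inter> ellipse a (a - e) \<noteq> {}"
      using billiard_map_line(1)[OF pos(2,3) cv(1) J J0] unfolding xe by (rule ex_in_conv[THEN iffD1, OF exI])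
  qed
qed

text \<open>The shift depends on the line only through M. Both sides are explicit triples that agree
  component by component after cross-multiplication by the denominators N and k.\<close>

lemma billiard_map_eq_add_map:
  assumes e: "0 \<le> e" "e < a" and x: "x \<in> add_curve e M" and M: "M \<le> a"
  shows "billiard_map (ellipse a (a - e)) (line x) = line (add_map e (billiard_shift a e M) x)"
proof -
  obtain s c p where xe: "x = (s, c, p)" by (cases x)
  have cv: "s\<^sup>2 + c\<^sup>2 = 1" "p\<^sup>2 + e * s\<^sup>2 = M" using x by (auto simp: xe add_curve_def)
  have M0: "M \<ge> 0" using cv(2) e by auto
  define J where "J = joachimsthal_integral a e M"
  define d where "d = M + a\<^sup>2 * J\<^sup>2"
  have J0: "J \<ge> 0" using M e by (simp add: J_def joachimsthal_integral_def)
  have J: "a * (a - e) * J\<^sup>2 = a - M" using joachimsthal_integral_sq M e by (simp add: J_def)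
  have J': "a * (a - e) * J\<^sup>2 = (a - e) * s\<^sup>2 + a * c\<^sup>2 - p\<^sup>2" using J cv by algebra
  have d: "d \<noteq> 0" using shift_denominator_pos M0 M e by (force simp: J_def d_def)
  have pos: "a - e > 0" "a - e \<le> a" using e by auto
  define n1 where "n1 = p * c + (a - e) * J * s"
  define n2 where "n2 = a * J * c - p * s"
  define q where "q = (a - e) * s\<^sup>2 + a * c\<^sup>2"
  define N where "N = n1\<^sup>2 + n2\<^sup>2"
  define S where "S = - 2 * a * J"
  define C where "C = M - a\<^sup>2 * J\<^sup>2"
  define D where "D = M - a\<^sup>2 * J\<^sup>2 + 2 * a * (a - e) * J\<^sup>2"
  \<comment> \<open>The addition denominator times d^2, so that the shift enters through its
    numerators S, C, D.\<close>
  define k where "k = d\<^sup>2 - e * S\<^sup>2 * s\<^sup>2"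
  have sh: "billiard_shift a e M = (S / d, C / d, D / d)"
    unfolding billiard_shift_def Let_def J_def[symmetric] d_def[symmetric] S_def C_def D_def by simp
  have kd: "1 - e * (S / d)\<^sup>2 * s\<^sup>2 = k / d\<^sup>2" using d by (simp add: k_def field_simps)
  have k: "k \<noteq> 0"
    using add_denominator_pos[of s c p e M "S / d" "C / d" "D / d"] x billiard_shift_mem[OF M0 M e] e kd
    unfolding xe sh by auto
  have N: "N \<noteq> 0"
    using billiard_map_line(2)[OF pos cv(1) J' J0] unfolding N_def n1_def n2_def by simp
  have add: "add_map e (billiard_shift a e M) x =
      ((s * C * D + d * S * c * p) / k, (d * c * C - S * s * p * D) / k,
       (d * p * D - e * S * s * c * C) / k)"
    unfolding sh xe add_map.simps kd using d k by (simp add: field_simps power2_eq_square)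
  have bil: "billiard_map (ellipse a (a - e)) (line x) =
      line (s - 2 * J * q / N * n1, c - 2 * J * q / N * n2, p - 2 * J * e / N * n1 * n2)"
    using billiard_map_line(3)[OF pos cv(1) J' J0]
    unfolding xe N_def n1_def n2_def q_def by simp
  note defs = k_def d_def S_def C_def D_def N_def n1_def n2_def q_def
  have "(s * C * D + d * S * c * p) * N = k * (s * N - 2 * J * q * n1)"
    using cv J' unfolding defs by algebra
  then have 1: "s - 2 * J * q / N * n1 = (s * C * D + d * S * c * p) / k"
    using k N by (simp add: field_simps)
  have "(d * c * C - S * s * p * D) * N = k * (c * N - 2 * J * q * n2)"
    using cv J' unfolding defs by algebra
  then have 2: "c - 2 * J * q / N * n2 = (d * c * C - S * s * p * D) / k"
    using k N by (simp add: field_simps)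
  have "(d * p * D - e * S * s * c * C) * N = k * (p * N - 2 * J * e * n1 * n2)"
    using cv J' unfolding defs by algebra
  then have 3: "p - 2 * J * e / N * n1 * n2 = (d * p * D - e * S * s * c * C) / k"
    using k N by (simp add: field_simps)
  show ?thesis unfolding bil add 1 2 3 ..
qed

text \<open>Every line lies on the curve of its own M, so the common domain is a union of whole
  curves; this is why translations along the curves preserve it.\<close>

lemma lines_meeting_both_ellipses:
  assumes "0 \<le> e" "e < a" "e < a'"
  shows "oriented_lines_meeting_both (ellipse a (a - e)) (ellipse a' (a' - e)) =
    {line x | x M. x \<in> add_curve e M \<and> M \<le> a \<and> M \<le> a'}"
proof -
  have lines: "oriented_lines = {line x | x M. x \<in> add_curve e M}"
    unfolding oriented_lines_eq by (auto simp: add_curve_def)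
  note iff = line_meets_ellipse_iff[OF assms(1,2)] line_meets_ellipse_iff[OF assms(1,3)]
  show ?thesis
  proof (intro equalityI subsetI)
    fix l assume "l \<in> oriented_lines_meeting_both (ellipse a (a - e)) (ellipse a' (a' - e))"
    then have l: "l \<in> oriented_lines" "fst l \<inter> ellipse a (a - e) \<noteq> {}"
      "fst l \<inter> ellipse a' (a' - e) \<noteq> {}"
      by (simp_all add: oriented_lines_meeting_both_def)
    obtain x M where x: "l = line x" "x \<in> add_curve e M" using l(1) unfolding lines by blast
    then have "M \<le> a" "M \<le> a'" using iff[OF x(2)] l(2,3) by simp_all
    with x show "l \<in> {line x | x M. x \<in> add_curve e M \<and> M \<le> a \<and> M \<le> a'}" by blast
  next
    fix l assume "l \<in> {line x | x M. x \<in> add_curve e M \<and> M \<le> a \<and> M \<le> a'}"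
    then obtain x M where x: "l = line x" "x \<in> add_curve e M" "M \<le> a" "M \<le> a'" by blast
    then have "l \<in> oriented_lines" unfolding lines by blast
    then show "l \<in> oriented_lines_meeting_both (ellipse a (a - e)) (ellipse a' (a' - e))"
      using iff[OF x(2)] x(1,3,4) by (simp add: oriented_lines_meeting_both_def)
  qed
qed

lemma billiard_map_invariant:
  assumes "0 \<le> e" "e < a" "e < a'"
    and "l \<in> oriented_lines_meeting_both (ellipse a (a - e)) (ellipse a' (a' - e))"
  shows "billiard_map (ellipse a (a - e)) l
    \<in> oriented_lines_meeting_both (ellipse a (a - e)) (ellipse a' (a' - e))"
proof -
  obtain x M where x: "l = line x" "x \<in> add_curve e M" "M \<le> a" "M \<le> a'"
    using assms(4) lines_meeting_both_ellipses[OF assms(1-3)] by auto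
  have "M \<ge> 0" using x(2) assms(1) by (auto simp: add_curve_def)
  then have "add_map e (billiard_shift a e M) x \<in> add_curve e M"
    using add_map_curve[OF x(2)] billiard_shift_mem x assms by simp
  then show ?thesis
    unfolding lines_meeting_both_ellipses[OF assms(1-3)]
    using billiard_map_eq_add_map[OF assms(1,2) x(2,3)] x(1,3,4)
    by (intro CollectI exI[of _ "add_map e (billiard_shift a e M) x"] exI[of _ M]) simp
qed

text \<open>The first reflection keeps M, so the second is again a translation of the same curve,
  and the two translations commute.\<close>

lemma billiard_maps_commute:
  assumes e: "0 \<le> e" "e < a" "e < a'"
    and l: "l \<in> oriented_lines_meeting_both (ellipse a (a - e)) (ellipse a' (a' - e))"
  shows "billiard_map (ellipse a (a - e)) (billiard_map (ellipse a' (a' - e)) l) =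
    billiard_map (ellipse a' (a' - e)) (billiard_map (ellipse a (a - e)) l)"
proof -
  obtain x M where x: "l = line x" "x \<in> add_curve e M" "M \<le> a" "M \<le> a'"
    using l lines_meeting_both_ellipses[OF e] by auto
  have "M \<ge> 0" using x(2) e(1) by (auto simp: add_curve_def)
  then have sh: "billiard_shift a e M \<in> add_shifts e M" "billiard_shift a' e M \<in> add_shifts e M"
    using billiard_shift_mem x e by auto
  show ?thesis
    using billiard_map_eq_add_map x e add_map_curve[OF x(2) sh(1) e(1)] add_map_curve[OF x(2) sh(2) e(1)]
      add_map_commute[OF x(2) sh e(1)]
    by simp
qed

end

section \<open>Foci\<close>

text \<open>The focal radii of a point of the ellipse are \<alpha> - h x / \<alpha> and \<alpha> + h
  x / \<alpha>. The forward direction eliminates the two distances from their sum and their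
  squares.\<close>

lemma focal_sum_iff:
  fixes h \<alpha> x y :: real
  assumes h: "0 \<le> h" "h < \<alpha>"
  shows "sqrt ((x - h)\<^sup>2 + y\<^sup>2) + sqrt ((x + h)\<^sup>2 + y\<^sup>2) = 2 * \<alpha> \<longleftrightarrow>
    (\<alpha>\<^sup>2 - h\<^sup>2) * x\<^sup>2 + \<alpha>\<^sup>2 * y\<^sup>2 = \<alpha>\<^sup>2 * (\<alpha>\<^sup>2 - h\<^sup>2)"
proof
  define d d' where "d = sqrt ((x - h)\<^sup>2 + y\<^sup>2)" and "d' = sqrt ((x + h)\<^sup>2 + y\<^sup>2)"
  assume "sqrt ((x - h)\<^sup>2 + y\<^sup>2) + sqrt ((x + h)\<^sup>2 + y\<^sup>2) = 2 * \<alpha>"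
  then have "d + d' = 2 * \<alpha>" by (simp add: d_def d'_def)
  moreover have "d\<^sup>2 = (x - h)\<^sup>2 + y\<^sup>2" "d'\<^sup>2 = (x + h)\<^sup>2 + y\<^sup>2" by (simp_all add: d_def d'_def)
  ultimately show "(\<alpha>\<^sup>2 - h\<^sup>2) * x\<^sup>2 + \<alpha>\<^sup>2 * y\<^sup>2 = \<alpha>\<^sup>2 * (\<alpha>\<^sup>2 - h\<^sup>2)"
    by algebra
next
  assume E: "(\<alpha>\<^sup>2 - h\<^sup>2) * x\<^sup>2 + \<alpha>\<^sup>2 * y\<^sup>2 = \<alpha>\<^sup>2 * (\<alpha>\<^sup>2 - h\<^sup>2)"
  have p: "\<alpha>\<^sup>2 - h\<^sup>2 > 0" using h by (simp add: power_strict_mono)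
  \<comment> \<open>Dropping the y term bounds x, which makes both focal radii nonnegative and hence
    equal to the square roots.\<close>
  have "(\<alpha>\<^sup>2 - h\<^sup>2) * x\<^sup>2 \<le> (\<alpha>\<^sup>2 - h\<^sup>2) * \<alpha>\<^sup>2"
    using E by (simp add: mult.commute) (metis add_le_same_cancel1 le_add_same_cancel1 zero_le_mult_iff zero_le_power2)
  then have "x\<^sup>2 \<le> \<alpha>\<^sup>2" using p by simp
  then have "\<bar>x\<bar> \<le> \<alpha>" using h abs_le_square_iff[of x \<alpha>] by simp
  then have "h * \<bar>x\<bar> \<le> \<alpha> * \<alpha>" using h by (intro mult_mono) auto
  then have b: "\<bar>h * x\<bar> \<le> \<alpha> * \<alpha>" using h by (simp add: abs_mult)
  have a: "\<alpha> > 0" using h by simp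
  have "sqrt ((x - h)\<^sup>2 + y\<^sup>2) = \<alpha> - h * x / \<alpha>"
  proof (rule real_sqrt_unique)
    show "0 \<le> \<alpha> - h * x / \<alpha>" using b a by (simp add: field_simps)
    have "(\<alpha> * \<alpha> - h * x)\<^sup>2 = \<alpha>\<^sup>2 * ((x - h)\<^sup>2 + y\<^sup>2)" using E by algebra
    moreover have "\<alpha> - h * x / \<alpha> = (\<alpha> * \<alpha> - h * x) / \<alpha>" using a by (simp add: field_simps)
    ultimately show "(\<alpha> - h * x / \<alpha>)\<^sup>2 = (x - h)\<^sup>2 + y\<^sup>2" using a by (simp add: power_divide)
  qed
  moreover have "sqrt ((x + h)\<^sup>2 + y\<^sup>2) = \<alpha> + h * x / \<alpha>"
  proof (rule real_sqrt_unique)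
    show "0 \<le> \<alpha> + h * x / \<alpha>" using b a by (simp add: field_simps)
    have "(\<alpha> * \<alpha> + h * x)\<^sup>2 = \<alpha>\<^sup>2 * ((x + h)\<^sup>2 + y\<^sup>2)" using E by algebra
    moreover have "\<alpha> + h * x / \<alpha> = (\<alpha> * \<alpha> + h * x) / \<alpha>" using a by (simp add: field_simps)
    ultimately show "(\<alpha> + h * x / \<alpha>)\<^sup>2 = (x + h)\<^sup>2 + y\<^sup>2" using a by (simp add: power_divide)
  qed
  ultimately show "sqrt ((x - h)\<^sup>2 + y\<^sup>2) + sqrt ((x + h)\<^sup>2 + y\<^sup>2) = 2 * \<alpha>" by simp
qed

lemma (in plane_frame) ellipse_with_foci_eq:
  assumes h: "0 \<le> h" and E: "ellipse_with_foci (z + h *\<^sub>R u) (z - h *\<^sub>R u) E"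
  shows "\<exists>a. h\<^sup>2 < a \<and> E = ellipse a (a - h\<^sup>2)"
proof -
  obtain r where r: "dist (z + h *\<^sub>R u) (z - h *\<^sub>R u) < r"
    and Er: "E = {X. dist X (z + h *\<^sub>R u) + dist X (z - h *\<^sub>R u) = r}"
    using E by (auto simp: ellipse_with_foci_def)
  have "(z + h *\<^sub>R u) - (z - h *\<^sub>R u) = (2 * h) *\<^sub>R u" by (simp add: scaleR_2 flip: scaleR_scaleR)
  then have "2 * h < r" using r h norm_u by (simp add: dist_norm)
  then have hr: "h < r / 2" by simp
  have d: "dist X (z + t *\<^sub>R u) = sqrt ((cx X - t)\<^sup>2 + (cy X)\<^sup>2)" for X t
  proof -
    have "X - (z + t *\<^sub>R u) = dir (cx X - t) (cy X)"
      using dir_components[of "X - z"] by (simp add: dir_def cx_def cy_def algebra_simps)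
    then show ?thesis by (simp add: dist_norm norm_eq_sqrt_inner inner_dir power2_eq_square)
  qed
  have "E = ellipse ((r / 2)\<^sup>2) ((r / 2)\<^sup>2 - h\<^sup>2)"
    using focal_sum_iff[OF h hr] d[of _ h] d[of _ "- h"] by (simp add: Er ellipse_def)
  moreover have "h\<^sup>2 < (r / 2)\<^sup>2" using h hr by (intro power_strict_mono) auto
  ultimately show ?thesis by blast
qed

text \<open>Confocality enters here: e is the squared half distance of the foci, hence common to
  both ellipses.\<close>

lemma confocal_ellipses_principal_axes:
  assumes "confocal_ellipses E E'"
  shows "\<exists>z u e a a'. norm u = 1 \<and> 0 \<le> e \<and> e < a \<and> e < a' \<and>
    E = plane_frame.ellipse z u a (a - e) \<and> E' = plane_frame.ellipse z u a' (a' - e)"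
proof -
  obtain f1 f2 where f: "ellipse_with_foci f1 f2 E" "ellipse_with_foci f1 f2 E'"
    using assms by (auto simp: confocal_ellipses_def)
  define h where "h = norm (f1 - f2) / 2"
  obtain u :: plane where u: "norm u = 1" "f1 - f2 = (2 * h) *\<^sub>R u"
  proof (cases "f1 = f2")
    case True
    \<comment> \<open>A circle has no distinguished axis; since h = 0, any unit vector
      serves.\<close>
    then show ?thesis using that[of "axis 1 1"] by (simp add: h_def norm_axis_1)
  next
    case False
    then show ?thesis using that[of "sgn (f1 - f2)"] by (simp add: h_def norm_sgn sgn_div_norm)
  qed
  \<comment> \<open>The midpoint of the foci.\<close>
  define z where "z = f2 + h *\<^sub>R u"
  have "f1 = f2 + (2 * h) *\<^sub>R u" using u(2) by (simp add: algebra_simps)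
  then have z: "f1 = z + h *\<^sub>R u" "f2 = z - h *\<^sub>R u"
    by (simp_all add: z_def scaleR_2 flip: scaleR_scaleR)
  interpret plane_frame z u using u by unfold_locales
  have "h \<ge> 0" by (simp add: h_def)
  then show ?thesis
    using ellipse_with_foci_eq[of h E] ellipse_with_foci_eq[of h E'] f u(1) unfolding z
    by (metis zero_le_power2)
qed

theorem theorem1:
  fixes \<aa> \<bb> :: "plane set"
  assumes "confocal_ellipses \<aa> \<bb>"
  shows "billiard_map \<aa> \<in> oriented_lines_meeting_both \<aa> \<bb> \<rightarrow> oriented_lines_meeting_both \<aa> \<bb>
    \<and> billiard_map \<bb> \<in> oriented_lines_meeting_both \<aa> \<bb> \<rightarrow> oriented_lines_meeting_both \<aa> \<bb>
    \<and> (\<forall>l \<in> oriented_lines_meeting_both \<aa> \<bb>.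
          billiard_map \<aa> (billiard_map \<bb> l) = billiard_map \<bb> (billiard_map \<aa> l))"
proof -
  obtain z u e a a' where u: "norm u = 1" and e: "0 \<le> e" "e < a" "e < a'"
    and E: "\<aa> = plane_frame.ellipse z u a (a - e)" "\<bb> = plane_frame.ellipse z u a' (a' - e)"
    using confocal_ellipses_principal_axes[OF assms] by blast
  interpret plane_frame z u using u by unfold_locales
  \<comment> \<open>Invariance under the second map comes from the same lemma with the ellipses
    exchanged.\<close>
  have sym: "oriented_lines_meeting_both \<bb> \<aa> = oriented_lines_meeting_both \<aa> \<bb>"
    by (auto simp: oriented_lines_meeting_both_def)
  show ?thesis
    using billiard_map_invariant[OF e] billiard_map_invariant[OF e(1,3,2)] billiard_maps_commute[OF e]
      sym unfolding E by auto
qed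

end
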